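(* Let $\mathbb{V}$ be an infinite dimensional vector space over a field $\mathbb{F}\neq\mathbb{F}_2$ and $\mathcal{K}=\{+\}\cup\{f_r:r\in\mathbb{F},r\neq0\}$, where $f_r(v)=r\cdot v$. Then $(\mathbb{V},\mathcal{K})$ is not a Ramsey algebra.
   Context: $\mathbb{F}_2$ is the two-element field. Orderly terms $\mathrm{OT}(\mathcal{K})$: smallest collection containing $\mathcal{K}$ and $\mathrm{id}_\mathbb{V}$, closed under $f(\bar x_1,\dots,\bar x_k)=g(h_1(\bar x_1),\dots,h_k(\bar x_k))$ for $k$-ary $g\in\mathcal{K}$, orderly terms $h_i$, consecutive disjoint variable blocks $\bar x_i$. For $\vec a,\vec b\in{}^\omega\mathbb{V}$, $\vec a\le_\mathcal{K}\vec b$ means there are orderly terms $f_j$ and finite subsequences $\vec b_j$ of $\vec b$ with $\vec a(j)=f_j(\bar b_j)$ for all $j\in\omega$ and $\vec b_0\ast\vec b_1\ast\cdots$ a subsequence of $\vec b$. $\mathrm{FR}_\mathcal{K}(\vec a)=\{f(\bar\tau):f\in\mathrm{OT}(\mathcal{K}),\ \vec\tau\text{ a finite subsequence of }\vec a\}$. $(\mathbb{V},\mathcal{K})$ is a Ramsey algebra if for every $\vec b\in{}^\omega\mathbb{V}$ and $X\subseteq\mathbb{V}$ there exists $\vec a\le_\mathcal{K}\vec b$ with $\mathrm{FR}_\mathcal{K}(\vec a)\subseteq X$ or $\mathrm{FR}_\mathcal{K}(\vec a)\cap X=\varnothing$. *)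

theory Defs imports Complex_Main
begin

text \<open>A finitary operation is a pair of its arity \<open>k\<close> and a function on argument lists; the
  function is only ever applied to lists of length \<open>k\<close>, its values elsewhere are irrelevant.
  The underlying set of an algebra is the whole type \<open>'a\<close>.\<close>

type_synonym 'a operation = "nat \<times> ('a list \<Rightarrow> 'a)"

primrec blocks :: "nat list \<Rightarrow> 'a list \<Rightarrow> 'a list list" where
  "blocks [] xs = []"
| "blocks (n # ns) xs = take n xs # blocks ns (drop n xs)"

inductive_set orderly_terms :: "'a operation set \<Rightarrow> 'a operation set"
  for K :: "'a operation set" where
  base: "p \<in> K \<Longrightarrow> p \<in> orderly_terms K"
| ident: "(1, \<lambda>xs. xs ! 0) \<in> orderly_terms K"
| comp: "\<lbrakk>(k, g) \<in> K; length hs = k; \<forall>h \<in> set hs. h \<in> orderly_terms K\<rbrakk> \<Longrightarrow>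
    (sum_list (map fst hs), \<lambda>xs. g (map2 snd hs (blocks (map fst hs) xs))) \<in> orderly_terms K"

definition finite_subsequence :: "'a list \<Rightarrow> (nat \<Rightarrow> 'a) \<Rightarrow> bool" where
  "finite_subsequence xs b \<longleftrightarrow> (\<exists>is. sorted_wrt (<) is \<and> xs = map b is)"

text \<open>The infinite concatenation \<open>bs 0 * bs 1 * \<dots>\<close> is a subsequence of \<open>b\<close>: the strictly
  increasing sequence of positions in \<open>b\<close> is given cut into blocks, \<open>I j\<close> being the positions of
  the entries of \<open>bs j\<close>.\<close>

definition concat_subsequence :: "(nat \<Rightarrow> 'a list) \<Rightarrow> (nat \<Rightarrow> 'a) \<Rightarrow> bool" where
  "concat_subsequence bs b \<longleftrightarrow>
     (\<exists>I. (\<forall>j. bs j = map b (I j)) \<and> (\<forall>n. sorted_wrt (<) (concat (map I [0..<n]))))"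

definition reduction :: "'a operation set \<Rightarrow> (nat \<Rightarrow> 'a) \<Rightarrow> (nat \<Rightarrow> 'a) \<Rightarrow> bool" where
  "reduction K a b \<longleftrightarrow>
     (\<exists>f bs. (\<forall>j. f j \<in> orderly_terms K \<and> finite_subsequence (bs j) b \<and>
               length (bs j) = fst (f j) \<and> a j = snd (f j) (bs j)) \<and>
             concat_subsequence bs b)"

definition FR :: "'a operation set \<Rightarrow> (nat \<Rightarrow> 'a) \<Rightarrow> 'a set" where
  "FR K a = {f xs | k f xs. (k, f) \<in> orderly_terms K \<and> finite_subsequence xs a \<and> length xs = k}"

definition ramsey_algebra :: "'a operation set \<Rightarrow> bool" where
  "ramsey_algebra K \<longleftrightarrow>
     (\<forall>b X. \<exists>a. reduction K a b \<and> (FR K a \<subseteq> X \<or> FR K a \<inter> X = {}))"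

definition vector_space_operations ::
  "('f::field \<Rightarrow> 'v::ab_group_add \<Rightarrow> 'v) \<Rightarrow> 'v operation set" where
  "vector_space_operations scale =
     {(2, \<lambda>xs. xs ! 0 + xs ! 1)} \<union> {(1, \<lambda>xs. scale r (xs ! 0)) | r. r \<noteq> 0}"

end

theory Submission imports Defs begin

text \<open>Let \<open>b\<close> be an injective sequence of basis vectors. An orderly term is a linear combination
  of its arguments with nonzero coefficients, so every reduction of \<open>b\<close> has nonzero entries. Let
  \<open>X\<close> contain exactly one vector of each orbit of the action of the nonzero scalars. A homogeneous
  set contains the whole orbit of a nonzero vector \<open>v\<close>, which has more than one element since there
  is a scalar other than \<open>0\<close> and \<open>1\<close>; hence it meets both \<open>X\<close> and its complement.\<close>

text \<open>The hypothesis also covers infinite fields, for which \<open>card\<close> takes the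
  default value 0.\<close>

lemma exists_scalar_neq_0_1:
  assumes "card (UNIV :: 'f::field set) \<noteq> 2"
  obtains s :: "'f::field" where "s \<noteq> 0" "s \<noteq> 1"
proof -
  have "(UNIV :: 'f set) \<noteq> {0, 1}"
    using assms by (metis card_2_iff zero_neq_one)
  then show thesis using that by auto
qed

context vector_space
begin

text \<open>Rules out empty argument lists, so that the supports computed below are
  nonempty.\<close>

lemma orderly_term_arity_pos:
  assumes "p \<in> orderly_terms (vector_space_operations scale)"
  shows "fst p > 0"
  using assms
proof induction
  case (comp k g hs)
  then obtain h hs' where "hs = h # hs'"
    by (cases hs) (auto simp: vector_space_operations_def)
  with comp show ?case by auto
qed (auto simp: vector_space_operations_def)

text \<open>Nonzero scaling preserves supports, and sums are taken over disjoint blocks of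
  arguments. Membership in the span is carried through the induction because
  \<open>representation\<close> is additive only there.\<close>

lemma orderly_term_representation_support:
  assumes "independent B" "p \<in> orderly_terms (vector_space_operations scale)"
    and "distinct xs" "set xs \<subseteq> B" "length xs = fst p"
  shows "snd p xs \<in> span B \<and> {v. representation B (snd p xs) v \<noteq> 0} = set xs"
  using assms(2-)
proof (induction arbitrary: xs)
  case (base p)
  then consider r where "r \<noteq> 0" "p = (1, \<lambda>xs. scale r (xs ! 0))"
    | "p = (2, \<lambda>xs. xs ! 0 + xs ! 1)"
    by (auto simp: vector_space_operations_def)
  then show ?case
  proof cases
    case 1
    with base obtain x where "xs = [x]" by (auto simp: length_Suc_conv)
    with 1 base assms(1) show ?thesis
      by (auto simp: representation_scale representation_basis span_base span_scale)
  next
    case 2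
    with base obtain x y where "xs = [x, y]" by (auto simp: length_Suc_conv numeral_2_eq_2)
    with 2 base assms(1) show ?thesis
      by (auto simp: representation_add representation_basis span_base span_add)
  qed
next
  case ident
  then obtain x where "xs = [x]" by (auto simp: length_Suc_conv)
  with ident assms(1) show ?case
    by (auto simp: representation_basis span_base)
next
  case (comp k g hs)
  then consider r where "r \<noteq> 0" "k = 1" "g = (\<lambda>xs. scale r (xs ! 0))"
    | "k = 2" "g = (\<lambda>xs. xs ! 0 + xs ! 1)"
    by (auto simp: vector_space_operations_def)
  then show ?case
  proof cases
    case 1
    with comp obtain h where h: "hs = [h]" by (auto simp: length_Suc_conv)
    then have "snd h xs \<in> span B \<and> {v. representation B (snd h xs) v \<noteq> 0} = set xs"
      using comp by auto
    with 1 h comp.prems assms(1) show ?thesis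
      by (auto simp: representation_scale span_scale)
  next
    case 2
    with comp obtain h1 h2 where h: "hs = [h1, h2]"
      by (auto simp: length_Suc_conv numeral_2_eq_2)
    define ys where "ys = take (fst h1) xs"
    define zs where "zs = drop (fst h1) xs"
    have xs: "xs = ys @ zs" by (simp add: ys_def zs_def)
    have len: "length ys = fst h1" "length zs = fst h2"
      using comp.prems h by (auto simp: ys_def zs_def)
    have "snd h1 ys \<in> span B \<and> {v. representation B (snd h1 ys) v \<noteq> 0} = set ys"
      and "snd h2 zs \<in> span B \<and> {v. representation B (snd h2 zs) v \<noteq> 0} = set zs"
      using comp h xs len by auto
    \<comment> \<open>The two summands share no basis vector, so no coefficient cancels.\<close>
    moreover have "set ys \<inter> set zs = {}" using comp.prems xs by simp
    moreover have "g (map2 snd hs (blocks (map fst hs) xs)) = snd h1 ys + snd h2 zs"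
      using 2 h comp.prems by (simp add: ys_def zs_def)
    ultimately show ?thesis
      using assms(1) xs by (fastforce simp: representation_add span_add)
  qed
qed

lemma reduction_of_independent_sequence_nonzero:
  assumes "inj b" "independent (range b)"
    and "reduction (vector_space_operations scale) a b"
  shows "a j \<noteq> 0"
proof
  assume zero: "a j = 0"
  obtain p xs where p: "p \<in> orderly_terms (vector_space_operations scale)"
    and xs: "finite_subsequence xs b" "length xs = fst p" and aj: "a j = snd p xs"
    using assms(3) unfolding reduction_def by blast
  from xs(1) obtain js where js: "sorted_wrt (<) js" "xs = map b js"
    unfolding finite_subsequence_def by blast
  then have "distinct xs" "set xs \<subseteq> range b"
    using assms(1) by (auto simp: distinct_map strict_sorted_iff intro: inj_on_subset)
  then have "{v. representation (range b) (a j) v \<noteq> 0} = set xs"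
    using orderly_term_representation_support[OF assms(2) p _ _ xs(2)] aj by simp
  with zero have "xs = []" by (simp add: representation_zero)
  with xs(2) orderly_term_arity_pos[OF p] show False by simp
qed

text \<open>Scalings are themselves orderly terms, so \<open>FR\<close> contains the whole orbit of
  each entry of \<open>a\<close>.\<close>

lemma scale_in_FR:
  assumes "r \<noteq> 0"
  shows "scale r (a j) \<in> FR (vector_space_operations scale) a"
proof -
  have "(1, \<lambda>xs. scale r (xs ! 0)) \<in> orderly_terms (vector_space_operations scale)"
    using assms by (auto simp: vector_space_operations_def intro: orderly_terms.base)
  moreover have "finite_subsequence [a j] a"
    unfolding finite_subsequence_def by (rule exI[of _ "[j]"]) simp
  ultimately show ?thesis
    unfolding FR_def
    by (intro CollectI exI[of _ 1] exI[of _ "\<lambda>xs. scale r (xs ! 0)"] exI[of _ "[a j]"]) simp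
qed

lemma orbit_transversal:
  obtains X where "\<And>v. \<exists>r. r \<noteq> 0 \<and> scale r v \<in> X"
    and "\<And>u s. u \<in> X \<Longrightarrow> scale s u \<in> X \<Longrightarrow> s \<noteq> 0 \<Longrightarrow> scale s u = u"
proof
  \<comment> \<open>The choice depends only on the orbit: the predicates for \<open>v\<close> and
    \<open>scale s v\<close> agree when \<open>s\<close> is nonzero, so \<open>SOME\<close> picks
    the same vector. The transversal is the set of fixed points of \<open>rep\<close>.\<close>
  define rep where "rep v = (SOME u. \<exists>r. r \<noteq> 0 \<and> u = scale r v)" for v
  have rep: "\<exists>r. r \<noteq> 0 \<and> rep v = scale r v" for v
    unfolding rep_def by (rule someI_ex) (auto intro: exI[of _ 1])
  have "(\<exists>r. r \<noteq> 0 \<and> u = scale r (scale s v)) \<longleftrightarrow> (\<exists>r. r \<noteq> 0 \<and> u = scale r v)"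
    if "s \<noteq> 0" for s u v
  proof
    assume "\<exists>r. r \<noteq> 0 \<and> u = scale r v"
    then obtain r where "r \<noteq> 0" "u = scale r v" by blast
    with that show "\<exists>r. r \<noteq> 0 \<and> u = scale r (scale s v)"
      by (intro exI[of _ "r / s"]) simp
  next
    assume "\<exists>r. r \<noteq> 0 \<and> u = scale r (scale s v)"
    with that show "\<exists>r. r \<noteq> 0 \<and> u = scale r v" by (metis mult_eq_0_iff scale_scale)
  qed
  then have rep_scale: "rep (scale s v) = rep v" if "s \<noteq> 0" for s v
    unfolding rep_def using that by simp
  show "\<exists>r. r \<noteq> 0 \<and> scale r v \<in> {v. rep v = v}" for v
    using rep[of v] rep_scale by auto
  show "scale s u = u" if "u \<in> {v. rep v = v}" "scale s u \<in> {v. rep v = v}" "s \<noteq> 0" for u s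
    using that rep_scale by simp
qed

text \<open>A basis of the whole space must be infinite, and any infinite set contains an injective
  sequence.\<close>

lemma infinite_dimensional_independent_sequence:
  assumes "\<nexists>B. finite_dimensional_vector_space scale B"
  obtains b :: "nat \<Rightarrow> 'b" where "inj b" "independent (range b)"
proof -
  obtain B where B: "independent B" "span B = UNIV"
    using independent_extend_basis[of "{}"] span_extend_basis[of "{}"] independent_empty by blast
  have "infinite B"
  proof
    assume "finite B"
    with B have "finite_dimensional_vector_space scale B" by unfold_locales auto
    with assms show False by blast
  qed
  then obtain b :: "nat \<Rightarrow> 'b" where "inj b" "range b \<subseteq> B"
    using infinite_countable_subset by blast
  with B show thesis using that independent_mono by blast
qed

end

theorem theorem7p4:
  fixes scale :: "'f::field \<Rightarrow> 'v::ab_group_add \<Rightarrow> 'v"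
  assumes "vector_space scale"
    and "\<nexists>B. finite_dimensional_vector_space scale B"
    and "card (UNIV :: 'f set) \<noteq> 2"
  shows "\<not> ramsey_algebra (vector_space_operations scale)"
proof
  interpret vector_space scale by fact
  assume ramsey: "ramsey_algebra (vector_space_operations scale)"
  obtain s :: 'f where s: "s \<noteq> 0" "s \<noteq> 1"
    using exists_scalar_neq_0_1 assms(3) by blast
  obtain b :: "nat \<Rightarrow> 'v" where b: "inj b" "independent (range b)"
    using infinite_dimensional_independent_sequence assms(2) by blast
  obtain X where X: "\<And>v. \<exists>r. r \<noteq> 0 \<and> scale r v \<in> X"
    and unique: "\<And>u s. u \<in> X \<Longrightarrow> scale s u \<in> X \<Longrightarrow> s \<noteq> 0 \<Longrightarrow> scale s u = u"
    using orbit_transversal by blast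
  obtain a where red: "reduction (vector_space_operations scale) a b"
    and hom: "FR (vector_space_operations scale) a \<subseteq> X \<or>
      FR (vector_space_operations scale) a \<inter> X = {}"
    using ramsey unfolding ramsey_algebra_def by blast
  obtain r where r: "r \<noteq> 0" "scale r (a 0) \<in> X" using X by blast
  \<comment> \<open>The vector \<open>scale r (a 0)\<close> lies in both \<open>FR\<close> and
    \<open>X\<close>, which leaves only the alternative that \<open>FR\<close> is contained in
    \<open>X\<close>.\<close>
  have "scale (s * r) (a 0) \<in> X"
    using hom r s scale_in_FR[of r a 0] scale_in_FR[of "s * r" a 0] by auto
  then have "scale s (scale r (a 0)) = scale r (a 0)"
    using unique[of "scale r (a 0)" s] r s by simp
  \<comment> \<open>A scalar \<open>s\<close> other than 1 fixes only the zero vector.\<close>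
  then have "a 0 = 0" using r s by auto
  with reduction_of_independent_sequence_nonzero[OF b red] show False by simp
qed

end
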